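(* There exist sets $A,B\subset[0,1]$ such that $$\dim_{MB}A+\dim_{MB}B<\dim_{MB}(A\times B).$$
   Context: $\mathbb{R}^n$ carries the Euclidean distance; $B(x,r)$ is the closed ball of centre $x$ and radius $r$. For $E\subset\mathbb{R}^n$ and $r>0$, $N_r(E)$ is the infimum of the numbers of elements of families of closed balls $(B(x_i,r))_{i\in I}$ with $x_i\in E$ and $E\subseteq\bigcup_iB(x_i,r)$. For $t\ge 0$, $\overline{\mathsf{H}}^t_r(E)=N_r(E)(2r)^t$, $\overline{\mathsf{H}}^t(E)=\liminf_{r\to0}\overline{\mathsf{H}}^t_r(E)$, and the Hewitt-Stromberg measure is $$\mathsf{H}^t(E)=\inf\Big\{\sum_i\overline{\mathsf{H}}^t(E_i) : E\subseteq\bigcup_iE_i\Big\},$$ over countable covers. The Hewitt-Stromberg dimension is $\dim_{MB}E=\sup\{t\ge0:\mathsf{H}^t(E)=+\infty\}=\inf\{t\ge0:\mathsf{H}^t(E)=0\}$. *)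

theory Defs
  imports "HOL-Analysis.Analysis"
begin

text \<open>
  A family of closed balls of radius \<open>r\<close> centred in \<open>E\<close> is given by its set \<open>C\<close> of centres:
  repeating a ball cannot lower the number of elements. An infinite family has \<open>\<infinity>\<close>
  elements, so only finite \<open>C\<close> matter, and the infimum is \<open>\<infinity>\<close> if there is no finite cover.
\<close>

definition covering_number :: "real \<Rightarrow> 'a::euclidean_space set \<Rightarrow> ennreal" where
  "covering_number r E =
     (INF C\<in>{C. finite C \<and> C \<subseteq> E \<and> E \<subseteq> (\<Union>x\<in>C. cball x r)}. of_nat (card C))"

definition HS_content :: "real \<Rightarrow> real \<Rightarrow> 'a::euclidean_space set \<Rightarrow> ennreal" where
  "HS_content t r E = covering_number r E * ennreal ((2 * r) powr t)"

definition HS_premeasure :: "real \<Rightarrow> 'a::euclidean_space set \<Rightarrow> ennreal" where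
  "HS_premeasure t E = Liminf (at_right 0) (\<lambda>r. HS_content t r E)"

text \<open>
  Finite covers are included, since sequences may be padded with the empty set
  (see \<open>HS_premeasure_empty\<close> below).
\<close>

definition HS_measure :: "real \<Rightarrow> 'a::euclidean_space set \<Rightarrow> ennreal" where
  "HS_measure t E =
     (INF F\<in>{F :: nat \<Rightarrow> 'a set. E \<subseteq> (\<Union>i. F i)}. (\<Sum>i. HS_premeasure t (F i)))"

text \<open>
  The supremum is taken in \<^typ>\<open>ennreal\<close>, so that it is \<open>0\<close> if no \<open>t \<ge> 0\<close> gives infinite measure.
\<close>

definition HS_dim :: "'a::euclidean_space set \<Rightarrow> ennreal" where
  "HS_dim E = (SUP t\<in>{t. 0 \<le> t \<and> HS_measure t E = \<infinity>}. ennreal t)"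

lemma HS_premeasure_empty: "HS_premeasure t {} = 0"
proof -
  have "covering_number r ({} :: 'a set) = 0" for r
  proof -
    have "covering_number r ({} :: 'a set) \<le> of_nat (card ({} :: 'a set))"
      unfolding covering_number_def by (rule INF_lower) auto
    then show ?thesis by simp
  qed
  then show ?thesis
    by (simp add: HS_premeasure_def HS_content_def Liminf_const)
qed

lemma HS_premeasure_eq_0:
  assumes "HS_premeasure s E < \<infinity>" and "s < t"
  shows "HS_premeasure t E = 0"
proof -
  obtain K where K: "HS_premeasure s E < ennreal K" "K > 0"
  proof -
    obtain k where "0 \<le> k" "HS_premeasure s E = ennreal k"
      using assms(1) by (cases "HS_premeasure s E") auto
    then show ?thesis using that[of "k + 1"] by (simp add: ennreal_less_iff)
  qed
  have freq: "\<exists>\<^sub>F r in at_right 0. HS_content s r E < ennreal K"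
  proof (rule ccontr)
    assume "\<not> ?thesis"
    then have "\<forall>\<^sub>F r in at_right 0. ennreal K \<le> HS_content s r E"
      by (simp add: not_frequently not_less)
    then have "ennreal K \<le> HS_premeasure s E"
      unfolding HS_premeasure_def by (rule Liminf_bounded)
    with K show False by simp
  qed
  have "HS_premeasure t E \<le> ennreal e" if "e > 0" for e
  proof (rule ccontr)
    assume "\<not> ?thesis"
    then have "ennreal e < Liminf (at_right 0) (\<lambda>r. HS_content t r E)"
      by (simp add: HS_premeasure_def)
    then have 1: "\<forall>\<^sub>F r in at_right 0. ennreal e < HS_content t r E"
      by (rule less_LiminfD)
    have "((\<lambda>r::real. K * (2 * r) powr (t - s)) \<longlongrightarrow> 0) (at_right 0)"
    proof -
      have "((\<lambda>r::real. 2 * r) \<longlongrightarrow> 2 * 0) (at_right 0)"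
        by (intro tendsto_mult tendsto_const tendsto_ident_at)
      moreover have "\<forall>\<^sub>F r::real in at_right 0. 0 \<le> 2 * r"
        using eventually_at_right_less[of "0::real"] by (rule eventually_mono) simp
      ultimately have "((\<lambda>r::real. (2 * r) powr (t - s)) \<longlongrightarrow> 0) (at_right 0)"
        using assms(2) by (intro tendsto_zero_powrI[where b = "t - s"]) simp_all
      then have "((\<lambda>r::real. K * (2 * r) powr (t - s)) \<longlongrightarrow> K * 0) (at_right 0)"
        by (intro tendsto_mult tendsto_const)
      then show ?thesis by simp
    qed
    then have 2: "\<forall>\<^sub>F r in at_right 0. K * (2 * r) powr (t - s) < e"
      using that by (rule order_tendstoD)
    have 3: "\<forall>\<^sub>F r::real in at_right 0. 0 < r"
      by (simp add: eventually_at_right_less)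
    obtain r where r: "HS_content s r E < ennreal K"
        "ennreal e < HS_content t r E" "K * (2 * r) powr (t - s) < e" "0 < r"
      using frequently_ex[OF frequently_eventually_conj
          [OF freq eventually_conj[OF 1 eventually_conj[OF 2 3]]]] by blast
    have "HS_content t r E = HS_content s r E * ennreal ((2 * r) powr (t - s))"
    proof -
      have "ennreal ((2 * r) powr t) = ennreal ((2 * r) powr s) * ennreal ((2 * r) powr (t - s))"
        using powr_add[of "2 * r" s "t - s"] by (simp add: ennreal_mult)
      then show ?thesis by (simp only: HS_content_def mult.assoc)
    qed
    also have "\<dots> \<le> ennreal K * ennreal ((2 * r) powr (t - s))"
      using r(1) by (intro mult_right_mono) auto
    also have "\<dots> = ennreal (K * (2 * r) powr (t - s))"
      using K(2) by (simp add: ennreal_mult)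
    also have "\<dots> \<le> ennreal e"
      using r(3) by (simp add: ennreal_leI)
    finally show False using r(2) by simp
  qed
  note bound = this
  have "HS_premeasure t E \<le> 0"
    by (rule ennreal_le_epsilon) (simp add: bound)
  then show ?thesis by simp
qed

lemma HS_measure_eq_0:
  assumes "HS_measure s E < \<infinity>" and "s < t"
  shows "HS_measure t E = 0"
proof -
  obtain F where F: "E \<subseteq> (\<Union>i. F i)" "(\<Sum>i. HS_premeasure s (F i)) < \<infinity>"
    using assms(1) unfolding HS_measure_def INF_less_iff by blast
  have "HS_premeasure s (F i) < \<infinity>" for i
  proof -
    have "(\<Sum>j\<in>{i}. HS_premeasure s (F j)) \<le> (\<Sum>i. HS_premeasure s (F i))"
      by (rule sum_le_suminf) auto
    with F(2) show ?thesis by (simp add: le_less_trans)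
  qed
  then have "HS_premeasure t (F i) = 0" for i
    using HS_premeasure_eq_0 assms(2) by blast
  then have "(\<Sum>i. HS_premeasure t (F i)) = 0" by simp
  moreover have "HS_measure t E \<le> (\<Sum>i. HS_premeasure t (F i))"
    unfolding HS_measure_def using F(1) by (intro INF_lower) simp
  ultimately show ?thesis by simp
qed

lemma HS_dim_eq_Inf:
  "HS_dim E = (INF t\<in>{t. 0 \<le> t \<and> HS_measure t E = 0}. ennreal t)"
  (is "_ = ?I")
proof (rule antisym)
  show "HS_dim E \<le> ?I"
    unfolding HS_dim_def
  proof (intro SUP_least INF_greatest)
    fix s t assume "s \<in> {t. 0 \<le> t \<and> HS_measure t E = \<infinity>}"
      and "t \<in> {t. 0 \<le> t \<and> HS_measure t E = 0}"
    then have "s \<le> t"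
      using HS_measure_eq_0[of t E s] by (cases "s \<le> t") auto
    then show "ennreal s \<le> ennreal t" by (rule ennreal_leI)
  qed
  show "?I \<le> HS_dim E"
  proof (rule ccontr)
    assume "\<not> ?thesis"
    then have "HS_dim E < ?I" by simp
    then obtain a where a: "HS_dim E < a" "a < ?I" using dense by blast
    then obtain b where b: "a < b" "b < ?I" using dense by blast
    obtain s where s: "a = ennreal s" "0 \<le> s"
      using b(1) by (cases a) auto
    obtain t where t: "b = ennreal t" "0 \<le> t"
      using b(2) by (cases b) auto
    have "s < t" using b(1) s t by (simp add: ennreal_less_iff)
    have "HS_measure s E \<noteq> \<infinity>"
    proof
      assume "HS_measure s E = \<infinity>"
      then have "ennreal s \<le> HS_dim E"
        unfolding HS_dim_def using s(2) by (intro SUP_upper) simp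
      with a(1) s(1) show False by simp
    qed
    then have "HS_measure t E = 0"
      using \<open>s < t\<close> by (intro HS_measure_eq_0[of s]) (simp_all add: less_top)
    then have "?I \<le> ennreal t"
      using t(2) by (intro INF_lower) simp
    with b(2) t(1) show False by simp
  qed
qed

end

theory Submission
  imports Defs
begin

text \<open>
  Let \<open>P\<close> be a set of natural numbers such that both \<open>P\<close> and its complement have gaps \<open>[m, k m)\<close>
  for every \<open>k\<close>. Let \<open>A\<close> and \<open>B\<close> be the sets of reals whose binary digits are supported in \<open>P\<close>
  and in \<open>- P\<close>. Across a gap \<open>[m, k m)\<close> such a set is covered by \<open>2 ^ m\<close> intervals of length
  \<open>2 powr (- k m)\<close>, so both have dimension \<open>0\<close>. But \<open>A + B\<close> contains \<open>[0, 1)\<close>, and addition is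
  Lipschitz, so the one-dimensional measure of \<open>A \<times> B\<close> is positive.
\<close>

section \<open>Covering numbers and a criterion for dimension zero\<close>

text \<open>Balls must be centred in \<open>E\<close>, so one point of each fibre of
  \<open>f\<close> serves as centre; its ball contains the fibre, whose points are at distance at
  most \<open>r\<close> from each other.\<close>

lemma covering_number_le_card:
  assumes "finite (f ` E)" and "\<And>x y. x \<in> E \<Longrightarrow> y \<in> E \<Longrightarrow> f x = f y \<Longrightarrow> dist x y \<le> r"
  shows "covering_number r E \<le> of_nat (card (f ` E))"
proof -
  define C where "C = inv_into E f ` f ` E"
  have "E \<subseteq> (\<Union>x\<in>C. cball x r)"
  proof
    fix x assume "x \<in> E"
    then have "dist (inv_into E f (f x)) x \<le> r"
      by (intro assms(2)) (auto simp: inv_into_into f_inv_into_f)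
    with \<open>x \<in> E\<close> show "x \<in> (\<Union>x\<in>C. cball x r)"
      unfolding C_def by auto
  qed
  moreover have "finite C" "C \<subseteq> E"
    using assms(1) by (auto simp: C_def inv_into_into)
  ultimately have "covering_number r E \<le> of_nat (card C)"
    unfolding covering_number_def by (intro INF_lower) auto
  also have "\<dots> \<le> of_nat (card (f ` E))"
    using assms(1) by (auto simp: C_def intro!: card_image_le)
  finally show ?thesis .
qed

lemma HS_measure_le_HS_premeasure: "HS_measure t E \<le> HS_premeasure t E"
proof -
  define F where "F i = (if i = 0 then E else {})" for i :: nat
  have "HS_measure t E \<le> (\<Sum>i. HS_premeasure t (F i))"
    unfolding HS_measure_def by (intro INF_lower) (auto simp: F_def)
  also have "\<dots> = (\<Sum>i\<in>{0}. HS_premeasure t (F i))"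
    by (intro suminf_finite) (auto simp: F_def HS_premeasure_empty)
  finally show ?thesis by (simp add: F_def)
qed

text \<open>A finite premeasure bounds the measure, so no positive exponent has infinite measure;
  the exponent 0 can contribute only 0 to the supremum.\<close>

lemma HS_dim_eq_0:
  assumes "\<And>s. 0 < s \<Longrightarrow> HS_premeasure s E < \<infinity>"
  shows "HS_dim E = 0"
proof -
  have "ennreal t \<le> 0" if "0 \<le> t" "HS_measure t E = \<infinity>" for t
    using that assms[of t] HS_measure_le_HS_premeasure[of t E]
    by (cases "t = 0") auto
  then have "HS_dim E \<le> 0"
    unfolding HS_dim_def by (intro SUP_least) auto
  then show ?thesis by simp
qed

section \<open>Binary expansions\<close>

text \<open>\<open>S\<close> is the set of positions of the digit 1, so numbers with digits
  supported in \<open>P\<close> form the image of \<open>Pow P\<close>. The map is not injective: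
  dyadic rationals strictly between 0 and 1 have two expansions.\<close>

definition binary_value :: "nat set \<Rightarrow> real" where
  "binary_value S = (\<Sum>j. indicator S j * (1/2) ^ Suc j)"

lemma summable_binary: "summable (\<lambda>j. indicator S j * (1/2 :: real) ^ Suc j)"
  by (rule summable_comparison_test'[OF sums_summable[OF power_half_series]])
     (auto simp: indicator_def)

lemma binary_value_in_unit_interval: "binary_value S \<in> {0..1}"
proof -
  have "binary_value S \<le> (\<Sum>j. (1/2) ^ Suc j)"
    unfolding binary_value_def
    by (intro suminf_le summable_binary sums_summable[OF power_half_series])
       (auto simp: indicator_def)
  also have "\<dots> = 1" by (rule sums_unique[OF power_half_series, symmetric])
  finally show ?thesis
    unfolding binary_value_def using summable_binary[of S] by (auto intro!: suminf_nonneg)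
qed

text \<open>The tail after \<open>n\<close> digits is a scaled binary value, hence at most 2^-n;
  numbers sharing their first \<open>n\<close> digits are therefore 2^-n-close.\<close>

lemma binary_value_split:
  "binary_value S = (\<Sum>j<n. indicator S j * (1/2) ^ Suc j) + (1/2) ^ n * binary_value {j. j + n \<in> S}"
proof -
  have "(\<Sum>j. indicator S (j + n) * (1/2 :: real) ^ Suc (j + n))
      = (\<Sum>j. (1/2) ^ n * (indicator {j. j + n \<in> S} j * (1/2) ^ Suc j))"
    by (rule suminf_cong) (simp add: indicator_def power_add)
  also have "\<dots> = (1/2) ^ n * binary_value {j. j + n \<in> S}"
    unfolding binary_value_def by (intro suminf_mult summable_binary)
  finally show ?thesis
    unfolding binary_value_def[of S] using suminf_split_initial_segment[OF summable_binary[of S], of n]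
    by simp
qed

text \<open>Disjoint supports never put two 1s in the same position, so no carrying occurs.\<close>

lemma binary_value_disjoint_Un:
  assumes "S \<inter> T = {}"
  shows "binary_value (S \<union> T) = binary_value S + binary_value T"
  unfolding binary_value_def
  by (subst suminf_add[OF summable_binary summable_binary], rule suminf_cong)
     (use assms in \<open>auto simp: indicator_def\<close>)

lemma binary_expansion_exists:
  assumes "0 \<le> x" "x < 1"
  shows "\<exists>S. binary_value S = x"
proof -
  \<comment> \<open>Digit \<open>j\<close> of \<open>x\<close> is the parity of floor(2^(j+1) x).
    With this choice the first \<open>n\<close> digits sum to floor(2^n x) / 2^n, which is within
    2^-n of \<open>x\<close>.\<close>
  define S where "S = {j. odd \<lfloor>2 ^ Suc j * x\<rfloor>}"
  have step: "\<lfloor>2 * y\<rfloor> = 2 * \<lfloor>y\<rfloor> + (if odd \<lfloor>2 * y\<rfloor> then 1 else 0)" for y :: real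
  proof -
    have "\<lfloor>2 * y\<rfloor> = 2 * \<lfloor>y\<rfloor> \<or> \<lfloor>2 * y\<rfloor> = 2 * \<lfloor>y\<rfloor> + 1" by linarith
    then show ?thesis by auto
  qed
  have partial: "(\<Sum>j<n. indicator S j * (1/2) ^ Suc j) = (of_int \<lfloor>2 ^ n * x\<rfloor> / 2 ^ n :: real)" for n
  proof (induction n)
    case 0
    have "\<lfloor>x\<rfloor> = 0" using assms by linarith
    then show ?case by simp
  next
    case (Suc n)
    have "(of_int \<lfloor>2 ^ Suc n * x\<rfloor> :: real) = 2 * of_int \<lfloor>2 ^ n * x\<rfloor> + indicator S n"
      using step[of "2 ^ n * x"] by (auto simp: S_def indicator_def mult.assoc)
    then show ?case using Suc by (simp add: field_simps)
  qed
  have bounds: "x - (1/2) ^ n \<le> of_int \<lfloor>2 ^ n * x\<rfloor> / 2 ^ n" "of_int \<lfloor>2 ^ n * x\<rfloor> / 2 ^ n \<le> x" for n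
  proof -
    have fl: "2 ^ n * x - 1 \<le> of_int \<lfloor>2 ^ n * x\<rfloor>" "of_int \<lfloor>2 ^ n * x\<rfloor> \<le> 2 ^ n * x"
      by linarith+
    have "x - (1/2) ^ n = (2 ^ n * x - 1) / 2 ^ n"
      by (simp add: diff_divide_distrib power_divide)
    also have "\<dots> \<le> of_int \<lfloor>2 ^ n * x\<rfloor> / 2 ^ n"
      by (rule divide_right_mono) (simp_all only: fl zero_le_power zero_le_numeral)
    finally show "x - (1/2) ^ n \<le> of_int \<lfloor>2 ^ n * x\<rfloor> / 2 ^ n" .
    have "of_int \<lfloor>2 ^ n * x\<rfloor> / 2 ^ n \<le> 2 ^ n * x / 2 ^ n"
      by (rule divide_right_mono) (simp_all only: fl zero_le_power zero_le_numeral)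
    then show "of_int \<lfloor>2 ^ n * x\<rfloor> / 2 ^ n \<le> x" by simp
  qed
  have "(\<lambda>n. x - (1/2) ^ n) \<longlonglongrightarrow> x - 0"
    by (intro tendsto_diff tendsto_const LIMSEQ_power_zero) simp
  then have lim: "(\<lambda>n. x - (1/2) ^ n) \<longlonglongrightarrow> x" by simp
  have "(\<lambda>n. of_int \<lfloor>2 ^ n * x\<rfloor> / 2 ^ n) \<longlonglongrightarrow> x"
    by (rule tendsto_sandwich[OF _ _ lim tendsto_const]) (simp_all only: bounds eventually_True)
  then have "(\<lambda>j. indicator S j * (1/2) ^ Suc j) sums x"
    unfolding sums_def partial .
  from sums_unique[OF this] show ?thesis
    unfolding binary_value_def by metis
qed

section \<open>Dimension zero for digit sets with long gaps\<close>

text \<open>Digits in the gap vanish, so the first \<open>m\<close> digits determine the first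
  \<open>n\<close>, and there are at most 2^m patterns of them.\<close>

lemma covering_number_binary_le:
  assumes "P \<inter> {m..<n} = {}" "m \<le> n"
  shows "covering_number ((1/2) ^ n) (binary_value ` Pow P) \<le> 2 ^ m"
proof -
  \<comment> \<open>As \<open>binary_value\<close> is not injective, \<open>g\<close> fixes one
    expansion supported in \<open>P\<close> for each point; \<open>f\<close> keeps its first
    \<open>m\<close> digits.\<close>
  define g where "g = inv_into (Pow P) binary_value"
  define f where "f x = g x \<inter> {..<m}" for x
  have g: "g x \<subseteq> P" "binary_value (g x) = x" if "x \<in> binary_value ` Pow P" for x
    using that inv_into_into[OF that] f_inv_into_f[OF that] by (auto simp: g_def)
  have sub: "f ` binary_value ` Pow P \<subseteq> Pow {..<m}" by (auto simp: f_def)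
  have "dist x y \<le> (1/2) ^ n"
    if x: "x \<in> binary_value ` Pow P" and y: "y \<in> binary_value ` Pow P" and eq: "f x = f y" for x y
  proof -
    have "j \<in> g x \<longleftrightarrow> j \<in> g y" if "j < n" for j
    proof (cases "j < m")
      case True
      then show ?thesis using eq by (auto simp: f_def)
    next
      case False
      then show ?thesis using g[OF x] g[OF y] assms that by fastforce
    qed
    then have "(\<Sum>j<n. indicator (g x) j * (1/2 :: real) ^ Suc j)
             = (\<Sum>j<n. indicator (g y) j * (1/2) ^ Suc j)"
      by (intro sum.cong) (auto simp: indicator_def)
    then have "x - y = (1/2) ^ n * (binary_value {j. j + n \<in> g x} - binary_value {j. j + n \<in> g y})"
      using binary_value_split[of "g x" n] binary_value_split[of "g y" n] g[OF x] g[OF y]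
      by (simp add: algebra_simps)
    moreover have "\<bar>binary_value {j. j + n \<in> g x} - binary_value {j. j + n \<in> g y}\<bar> \<le> 1"
      using binary_value_in_unit_interval[of "{j. j + n \<in> g x}"]
            binary_value_in_unit_interval[of "{j. j + n \<in> g y}"] by auto
    ultimately show ?thesis
      unfolding dist_real_def by (simp add: abs_mult mult_left_le)
  qed
  then have "covering_number ((1/2) ^ n) (binary_value ` Pow P)
      \<le> of_nat (card (f ` binary_value ` Pow P))"
    by (intro covering_number_le_card finite_subset[OF sub]) auto
  also have "\<dots> \<le> of_nat (card (Pow {..<m}))"
    by (intro of_nat_mono card_mono sub) auto
  also have "\<dots> = 2 ^ m" by (simp add: card_Pow)
  finally show ?thesis .
qed

text \<open>The premeasure is a lower limit, so bounded content along the radii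
  \<open>(1/2) ^ (k * m)\<close> suffices. Since \<open>m > 0\<close>, these radii become
  arbitrarily small as \<open>k\<close> grows.\<close>

lemma HS_dim_binary_eq_0:
  assumes "\<And>k::nat. \<exists>m>0. P \<inter> {m..<k * m} = {}"
  shows "HS_dim (binary_value ` Pow P) = 0"
proof (rule HS_dim_eq_0)
  let ?E = "binary_value ` Pow P"
  fix s :: real assume s: "0 < s"
  have "HS_premeasure s ?E \<le> 1"
  proof (rule ccontr)
    assume "\<not> ?thesis"
    then have "1 < Liminf (at_right 0) (\<lambda>r. HS_content s r ?E)"
      by (simp add: HS_premeasure_def)
    then have "\<forall>\<^sub>F r in at_right 0. 1 < HS_content s r ?E"
      by (rule less_LiminfD)
    then obtain b where b: "0 < b" "\<And>r. 0 < r \<Longrightarrow> r < b \<Longrightarrow> 1 < HS_content s r ?E"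
      unfolding eventually_at_right_field by auto
    obtain k1 where k1: "(1/2) ^ k1 < b"
      using real_arch_pow_inv[OF b(1), of "1/2"] by auto
    obtain k2 :: nat where k2: "1 / s + 1 \<le> k2"
      using real_arch_simple by blast
    \<comment> \<open>\<open>k1\<close> brings the radius below \<open>b\<close>, \<open>k2\<close>
      makes the final exponent of 2 nonpositive, and 1 ensures \<open>m \<le> k * m\<close>.\<close>
    define k where "k = max (max k1 k2) 1"
    obtain m where m: "0 < m" "P \<inter> {m..<k * m} = {}" using assms by blast
    have "k1 \<le> k" "1 \<le> k" by (auto simp: k_def)
    moreover have "k * 1 \<le> k * m" using m(1) by (intro mult_le_mono2) simp
    ultimately have "k1 \<le> k * m" by linarith
    then have "(1/2 :: real) ^ (k * m) \<le> (1/2) ^ k1"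
      by (intro power_decreasing) auto
    with k1 have "(1/2) ^ (k * m) < b" by linarith
    then have "1 < HS_content s ((1/2) ^ (k * m)) ?E"
      by (intro b(2)) simp_all
    also have "\<dots> \<le> 2 ^ m * ennreal ((2 * (1/2) ^ (k * m)) powr s)"
      unfolding HS_content_def using m \<open>1 \<le> k\<close>
      by (intro mult_right_mono covering_number_binary_le) auto
    also have "\<dots> = ennreal (2 ^ m * (2 * (1/2) ^ (k * m)) powr s)"
      by (simp add: ennreal_mult flip: ennreal_power)
    also have "\<dots> \<le> ennreal 1"
    proof (rule ennreal_leI)
      have "2 * (1/2 :: real) ^ (k * m) = 2 powr (1 - real (k * m))"
        by (simp add: powr_diff powr_realpow power_one_over del: of_nat_mult)
      then have "2 ^ m * (2 * (1/2) ^ (k * m)) powr s = 2 powr (m + (1 - real (k * m)) * s)"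
        by (simp only: powr_powr powr_add powr_realpow zero_less_numeral)
      also have "\<dots> \<le> 2 powr 0"
      proof (rule powr_mono)
        have "1 / s \<le> real k - 1" using k2 by (auto simp: k_def)
        then have "1 \<le> (real k - 1) * s" using s by (simp add: field_simps)
        then have "real m \<le> m * ((real k - 1) * s)"
          using mult_left_mono[of 1 _ "real m"] by simp
        also have "\<dots> = (real (k * m) - m) * s" by (simp add: algebra_simps)
        \<comment> \<open>The 1 stems from the factor 2 in the diameter \<open>2 * r\<close>; it is
          absorbed because \<open>m \<ge> 1\<close>.\<close>
        also have "\<dots> \<le> (real (k * m) - 1) * s"
          using m(1) s by (intro mult_right_mono) auto
        finally show "m + (1 - real (k * m)) * s \<le> 0" by (simp add: algebra_simps)
      qed simp
      finally show "2 ^ m * (2 * (1/2) ^ (k * m)) powr s \<le> (1 :: real)" by simp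
    qed
    finally show False by simp
  qed
  then show "HS_premeasure s ?E < \<infinity>"
    using ennreal_one_less_top by (simp add: order_le_less_trans)
qed

section \<open>Lower bound for the product\<close>

text \<open>Addition sends a ball of radius \<open>r\<close> into an interval of length
  \<open>4 * r\<close>, twice its diameter. The closure makes the set of sums measurable for
  arbitrary \<open>F\<close>, and a finite union of closed intervals covering the sums covers the
  closure too.\<close>

lemma emeasure_closure_sums_le:
  fixes F :: "(real \<times> real) set"
  shows "emeasure lborel (closure ((\<lambda>(x, y). x + y) ` F)) \<le> 2 * HS_premeasure 1 F"
proof -
  let ?G = "(\<lambda>(x, y). x + y) ` F"
  have "emeasure lborel (closure ?G) / 2 \<le> HS_content 1 r F" if r: "0 < r" for r
  proof -
    \<comment> \<open>Dividing by \<open>2 * r\<close> isolates the number of balls, so that the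
      infimum over \<open>C\<close> can be taken before multiplying back.\<close>
    have "emeasure lborel (closure ?G) / 2 / ennreal (2 * r) \<le> of_nat (card C)"
      if C: "finite C" "C \<subseteq> F" "F \<subseteq> (\<Union>x\<in>C. cball x r)" for C
    proof -
      have "?G \<subseteq> (\<Union>c\<in>C. {fst c + snd c - 2 * r .. fst c + snd c + 2 * r})"
      proof clarify
        fix x y assume "(x, y) \<in> F"
        then obtain c where c: "c \<in> C" "dist c (x, y) \<le> r" using C by auto
        then have "dist (fst c) x \<le> r" "dist (snd c) y \<le> r"
          using dist_fst_le[of c "(x, y)"] dist_snd_le[of c "(x, y)"] by auto
        then show "x + y \<in> (\<Union>c\<in>C. {fst c + snd c - 2 * r .. fst c + snd c + 2 * r})"
          by (intro UN_I[OF c(1)]) (auto simp: dist_real_def)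
      qed
      then have "closure ?G \<subseteq> (\<Union>c\<in>C. {fst c + snd c - 2 * r .. fst c + snd c + 2 * r})"
        using C(1) by (intro closure_minimal closed_UN) auto
      then have "emeasure lborel (closure ?G)
          \<le> emeasure lborel (\<Union>c\<in>C. {fst c + snd c - 2 * r .. fst c + snd c + 2 * r})"
        using C(1) by (intro emeasure_mono) auto
      also have "\<dots> \<le> (\<Sum>c\<in>C. emeasure lborel {fst c + snd c - 2 * r .. fst c + snd c + 2 * r})"
        using C(1) by (intro emeasure_subadditive_finite) auto
      also have "\<dots> = of_nat (card C) * ennreal (4 * r)"
        using r by simp
      also have "\<dots> = of_nat (card C) * ennreal (2 * r) * 2"
        using r by (simp add: ennreal_mult mult_ac flip: ennreal_numeral)
           (simp add: ennreal_mult[symmetric])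
      finally show ?thesis
        using r by (intro divide_le_posI_ennreal) (auto simp: mult_ac)
    qed
    then have "emeasure lborel (closure ?G) / 2 / ennreal (2 * r) \<le> covering_number r F"
      unfolding covering_number_def by (intro INF_greatest) auto
    then have "emeasure lborel (closure ?G) / 2 / ennreal (2 * r) * ennreal (2 * r)
        \<le> covering_number r F * ennreal (2 * r)"
      by (rule mult_right_mono) simp
    then show ?thesis
      unfolding HS_content_def using r by (simp add: ennreal_divide_times)
  qed
  then have "emeasure lborel (closure ?G) / 2 \<le> HS_premeasure 1 F"
    unfolding HS_premeasure_def
    by (intro Liminf_bounded eventually_mono[OF eventually_at_right_less[of 0]]) auto
  then have "emeasure lborel (closure ?G) / 2 * 2 \<le> HS_premeasure 1 F * 2"
    by (rule mult_right_mono) simp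
  also have "emeasure lborel (closure ?G) / 2 * 2 = emeasure lborel (closure ?G)"
    by (simp add: ennreal_divide_times)
  finally show ?thesis by (simp add: mult.commute)
qed

text \<open>For any countable cover of the product, the closed sets of sums cover [0, 1), so
  countable subadditivity of Lebesgue measure bounds the one-dimensional measure below by
  1/2.\<close>

lemma HS_dim_product_ge:
  fixes A B :: "real set"
  assumes "\<And>z. 0 \<le> z \<Longrightarrow> z < 1 \<Longrightarrow> \<exists>x\<in>A. \<exists>y\<in>B. z = x + y"
  shows "1/2 \<le> HS_dim (A \<times> B)"
proof -
  have "1 \<le> 2 * (\<Sum>i. HS_premeasure 1 (F i))" if F: "A \<times> B \<subseteq> (\<Union>i. F i)" for F :: "nat \<Rightarrow> _"
  proof -
    let ?G = "\<lambda>i. closure ((\<lambda>(x, y). x + y) ` F i)"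
    have "{0..<1} \<subseteq> (\<Union>i. ?G i)"
    proof
      fix z :: real assume "z \<in> {0..<1}"
      then obtain x y where "x \<in> A" "y \<in> B" "z = x + y" using assms[of z] by auto
      moreover from this F obtain i where "(x, y) \<in> F i" by blast
      ultimately show "z \<in> (\<Union>i. ?G i)"
        using closure_subset[of "(\<lambda>(x, y). x + y) ` F i"] by force
    qed
    then have "emeasure lborel {0..<1::real} \<le> emeasure lborel (\<Union>i. ?G i)"
      by (intro emeasure_mono) auto
    also have "\<dots> \<le> (\<Sum>i. emeasure lborel (?G i))"
      by (intro emeasure_subadditive_countably) auto
    also have "\<dots> \<le> (\<Sum>i. 2 * HS_premeasure 1 (F i))"
      by (intro suminf_le emeasure_closure_sums_le) auto
    finally show ?thesis by simp
  qed
  then have "HS_measure 1 (A \<times> B) \<noteq> 0"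
    unfolding HS_measure_def
    by (intro not_sym[OF less_imp_neq] less_le_trans[OF _ INF_greatest[of _ "1/2"]])
       (auto simp: divide_le_posI_ennreal ennreal_zero_less_divide)
  \<comment> \<open>Positive measure at exponent 1 forces infinite measure at smaller exponents; 1/2
    is a convenient one.\<close>
  then have "HS_measure (1/2) (A \<times> B) = \<infinity>"
    using HS_measure_eq_0[of "1/2" "A \<times> B" 1]
    by (cases "HS_measure (1/2) (A \<times> B) = \<infinity>") (auto simp: less_top)
  then have "ennreal (1/2) \<le> HS_dim (A \<times> B)"
    unfolding HS_dim_def by (intro SUP_upper) auto
  then show ?thesis by (simp add: ennreal_divide_numeral flip: ennreal_1)
qed

section \<open>Construction of the two sets\<close>

theorem mainTheorem5:
  shows "\<exists>(A :: real set) (B :: real set). A \<subseteq> {0..1} \<and> B \<subseteq> {0..1} \<and>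
           HS_dim A + HS_dim B < HS_dim (A \<times> B)"
proof -
  \<comment> \<open>Ratios of consecutive factorials are unbounded, so alternating the blocks
    between them gives long gaps both in \<open>P\<close> and in its complement.\<close>
  define P where "P = (\<Union>k. {fact (2 * k) ..< fact (2 * k + 1) :: nat})"
  let ?A = "binary_value ` Pow P" and ?B = "binary_value ` Pow (- P)"
  have "\<exists>m>0. P \<inter> {m..<k * m} = {}" for k :: nat
  proof (intro exI conjI)
    \<comment> \<open>The block from \<open>fact (2 * k + 1)\<close> to
      \<open>fact (2 * k + 2)\<close> misses \<open>P\<close>, and its endpoints have ratio
      \<open>2 * k + 2\<close>.\<close>
    show "P \<inter> {fact (2 * k + 1) ..< k * fact (2 * k + 1)} = {}"
    proof (rule ccontr)
      assume "\<not> ?thesis"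
      then obtain j l where j: "fact (2 * k + 1) \<le> j" "j < k * fact (2 * k + 1)"
        "fact (2 * l) \<le> j" "j < fact (2 * l + 1)" by (auto simp: P_def)
      have "k * fact (2 * k + 1) \<le> fact (2 * k + 2)"
        by (simp add: fact_Suc)
      then have "\<not> 2 * k + 2 \<le> 2 * l"
        using j fact_mono_nat[of "2 * k + 2" "2 * l"] by linarith
      then have "fact (2 * l + 1) \<le> (fact (2 * k + 1) :: nat)"
        by (intro fact_mono_nat) presburger
      with j show False by linarith
    qed
  qed simp
  then have A: "HS_dim ?A = 0" by (rule HS_dim_binary_eq_0)
  have "\<exists>m>0. - P \<inter> {m..<k * m} = {}" for k :: nat
  proof (intro exI conjI)
    \<comment> \<open>For the complement the gap is the block of \<open>P\<close> with index
      \<open>k\<close>, whose endpoints have ratio \<open>2 * k + 1\<close>.\<close>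
    have "k * fact (2 * k) \<le> (fact (2 * k + 1) :: nat)" by simp
    then show "- P \<inter> {fact (2 * k) ..< k * fact (2 * k)} = {}"
      unfolding P_def by fastforce
  qed simp
  then have B: "HS_dim ?B = 0" by (rule HS_dim_binary_eq_0)
  have "1/2 \<le> HS_dim (?A \<times> ?B)"
  proof (rule HS_dim_product_ge)
    fix z :: real assume "0 \<le> z" "z < 1"
    then obtain S where "binary_value S = z" using binary_expansion_exists by blast
    \<comment> \<open>The digits of \<open>z\<close> are distributed between \<open>P\<close> and
      its complement.\<close>
    then have "z = binary_value (S \<inter> P) + binary_value (S - P)"
      using binary_value_disjoint_Un[of "S \<inter> P" "S - P"] by (simp add: Int_Diff_Un Int_Diff_disjoint)
    then show "\<exists>x\<in>?A. \<exists>y\<in>?B. z = x + y" by blast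
  qed
  then have "HS_dim ?A + HS_dim ?B < HS_dim (?A \<times> ?B)"
    unfolding A B by (rule less_le_trans[rotated]) (simp add: ennreal_zero_less_divide)
  then show ?thesis
    using binary_value_in_unit_interval by (intro exI[of _ ?A] exI[of _ ?B]) blast
qed

end
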